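(* Let $\mathcal{K}$ and $\mathcal{H}$ be complex Hilbert spaces, let $\mathcal{A} \subset B(\mathcal{K})$ be a unital operator algebra, and let $\theta: \mathcal{A} \to B(\mathcal{H})$ be a continuous unital algebra homomorphism. Then for all $n \in \mathbb{N}$ and all $\beta$ in the dual space of $\mathcal{A}$ (i.e. all continuous linear functionals $\beta : \mathcal{A} \to \mathbb{C}$), $$\|\theta^{(n)}\| \le \max\bigl(1, \|\theta^{(n)} + \beta^{(n)} I\|\bigr).$$
   Context: An operator algebra is a (complex linear) subalgebra $\mathcal{A}$ of $B(\mathcal{K})$, the bounded operators on a Hilbert space $\mathcal{K}$, with the operator norm; it is not assumed self-adjoint, nor norm-closed. It is unital if it contains $I_{\mathcal{K}}$, and $\theta$ unital means $\theta(I_{\mathcal{K}}) = I_{\mathcal{H}}$. The algebra $\mathcal{M}_n(\mathcal{A})$ of $n \times n$ matrices with entries in $\mathcal{A}$ is a subalgebra of $\mathcal{M}_n(B(\mathcal{K}))$, which is canonically identified with $B(\mathcal{K}^n)$, and $\mathcal{M}_n(\mathcal{A})$ carries the resulting operator norm. Likewise $\mathcal{M}_n(B(\mathcal{H})) = B(\mathcal{H}^n)$. For a linear map $\varphi: \mathcal{A} \to B(\mathcal{H})$, the $n$-th ampliation $\varphi^{(n)} : \mathcal{M}_n(\mathcal{A}) \to \mathcal{M}_n(B(\mathcal{H}))$ is given by applying $\varphi$ entrywise, and $\|\varphi^{(n)}\|$ is its operator norm as a linear map between normed spaces. The map $\theta + \beta I : \mathcal{A} \to B(\mathcal{H})$ is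 $(\theta + \beta I)(a) = \theta(a) + \beta(a) I_{\mathcal{H}}$, and $\theta^{(n)} + \beta^{(n)} I$ denotes its $n$-th ampliation, i.e. $[a_{ij}] \mapsto [\theta(a_{ij}) + \beta(a_{ij}) I_{\mathcal{H}}]$. *)

theory Defs
  imports "HOL-Analysis.Analysis"
begin

section \<open>Complex Hilbert spaces\<close>

class complex_vector = ab_group_add +
  fixes scaleC :: "complex \<Rightarrow> 'a \<Rightarrow> 'a"  (infixr "*\<^sub>C" 75)
  assumes scaleC_add_right: "c *\<^sub>C (x + y) = c *\<^sub>C x + c *\<^sub>C y"
    and scaleC_add_left: "(c + d) *\<^sub>C x = c *\<^sub>C x + d *\<^sub>C x"
    and scaleC_scaleC: "c *\<^sub>C d *\<^sub>C x = (c * d) *\<^sub>C x"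
    and scaleC_one: "1 *\<^sub>C x = x"

text \<open>
  A complex Hilbert space is a complete real inner product space with a compatible complex
  structure: real scalars act as before and the real inner product is the real part of the complex
  one, so that \<open>norm x = sqrt (Re (cinner x x))\<close>, where \<open>cinner x x\<close> is real by
  \<open>cinner_commute\<close>.  The complex inner product is conjugate-linear in its first argument.
\<close>

class chilbert_space = real_inner + complete_space + complex_vector +
  fixes cinner :: "'a \<Rightarrow> 'a \<Rightarrow> complex"
  assumes scaleR_scaleC: "scaleR r x = complex_of_real r *\<^sub>C x"
    and cinner_commute: "cinner x y = cnj (cinner y x)"
    and cinner_add_right: "cinner x (y + z) = cinner x y + cinner x z"
    and cinner_scaleC_right: "cinner x (c *\<^sub>C y) = c * cinner x y"
    and inner_cinner: "inner x y = Re (cinner x y)"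
begin

subclass banach ..

end

lemma norm_scaleC: "norm (c *\<^sub>C x) = cmod c * norm x" for x :: "'a :: chilbert_space"
proof -
  have "cinner (c *\<^sub>C x) (c *\<^sub>C x) = c * cnj (cinner x (c *\<^sub>C x))"
    using cinner_commute[of "c *\<^sub>C x" x] by (simp add: cinner_scaleC_right)
  also have "\<dots> = complex_of_real ((cmod c)\<^sup>2) * cnj (cinner x x)"
    by (simp add: cinner_scaleC_right complex_mult_cnj cmod_power2 flip: mult.assoc)
  finally have "inner (c *\<^sub>C x) (c *\<^sub>C x) = (cmod c)\<^sup>2 * inner x x"
    by (simp add: inner_cinner)
  then show ?thesis
    by (simp add: norm_eq_sqrt_inner real_sqrt_mult)
qed

lemma bounded_linear_scaleC: "bounded_linear (\<lambda>x :: 'a :: chilbert_space. c *\<^sub>C x)"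
  by (rule bounded_linear_intro[where K = "cmod c"])
    (simp_all add: scaleC_add_right scaleR_scaleC scaleC_scaleC norm_scaleC mult.commute)

instantiation complex :: chilbert_space
begin

definition scaleC_complex :: "complex \<Rightarrow> complex \<Rightarrow> complex"
  where "scaleC_complex c x = c * x"

definition cinner_complex :: "complex \<Rightarrow> complex \<Rightarrow> complex"
  where "cinner_complex x y = cnj x * y"

instance
  by standard
    (auto simp: scaleC_complex_def cinner_complex_def algebra_simps inner_complex_def
      scaleR_conv_of_real)

end

text \<open>
  The direct sum of finitely many copies of a Hilbert space; its library norm is already the
  Hilbert space norm \<open>sqrt (\<Sum>i\<in>UNIV. (norm (x $ i))\<^sup>2)\<close>.
\<close>

instantiation vec :: (chilbert_space, finite) chilbert_space
begin

definition scaleC_vec :: "complex \<Rightarrow> 'a ^ 'b \<Rightarrow> 'a ^ 'b"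
  where "scaleC_vec c x = (\<chi> i. c *\<^sub>C (x $ i))"

definition cinner_vec :: "'a ^ 'b \<Rightarrow> 'a ^ 'b \<Rightarrow> complex"
  where "cinner_vec x y = (\<Sum>i\<in>UNIV. cinner (x $ i) (y $ i))"

instance
proof
  fix x y :: "'a ^ 'b"
  show "cinner x y = cnj (cinner y x)"
    unfolding cinner_vec_def cnj_sum by (intro sum.cong refl cinner_commute)
qed (auto simp: scaleC_vec_def cinner_vec_def vec_eq_iff scaleC_add_right scaleC_add_left
      scaleC_scaleC scaleC_one scaleR_scaleC cinner_add_right cinner_scaleC_right inner_vec_def
      inner_cinner sum.distrib sum_distrib_left)

end


section \<open>Bounded operators and operator algebras\<close>

text \<open>
  The library type \<^typ>\<open>'a \<Rightarrow>\<^sub>L 'b\<close> consists of the bounded real-linear maps with the operator norm;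
  the complex-linear ones among them form \<open>B(\<H>)\<close>, a complex vector space under pointwise scaling.
\<close>

instantiation blinfun :: (real_normed_vector, chilbert_space) complex_vector
begin

lift_definition scaleC_blinfun :: "complex \<Rightarrow> 'a \<Rightarrow>\<^sub>L 'b \<Rightarrow> 'a \<Rightarrow>\<^sub>L 'b"
  is "\<lambda>c T x. c *\<^sub>C T x"
  by (rule bounded_linear_compose[OF bounded_linear_scaleC])

instance
  by standard (transfer; simp add: fun_eq_iff scaleC_add_right scaleC_add_left scaleC_scaleC
      scaleC_one)+

end

definition bounded_operators :: "('h :: chilbert_space \<Rightarrow>\<^sub>L 'h) set"
  where "bounded_operators = {T. \<forall>c x. blinfun_apply T (c *\<^sub>C x) = c *\<^sub>C blinfun_apply T x}"

definition unital_operator_algebra :: "('k :: chilbert_space \<Rightarrow>\<^sub>L 'k) set \<Rightarrow> bool"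
  where "unital_operator_algebra A \<longleftrightarrow>
    A \<subseteq> bounded_operators \<and>
    id_blinfun \<in> A \<and>
    (\<forall>S\<in>A. \<forall>T\<in>A. S + T \<in> A) \<and>
    (\<forall>c. \<forall>T\<in>A. c *\<^sub>C T \<in> A) \<and>
    (\<forall>S\<in>A. \<forall>T\<in>A. S o\<^sub>L T \<in> A)"

definition clinear_on :: "'a :: complex_vector set \<Rightarrow> ('a \<Rightarrow> 'b :: complex_vector) \<Rightarrow> bool"
  where "clinear_on A f \<longleftrightarrow>
    (\<forall>x\<in>A. \<forall>y\<in>A. f (x + y) = f x + f y) \<and>
    (\<forall>c. \<forall>x\<in>A. f (c *\<^sub>C x) = c *\<^sub>C f x)"

definition continuous_dual ::
    "('k :: chilbert_space \<Rightarrow>\<^sub>L 'k) set \<Rightarrow> (('k \<Rightarrow>\<^sub>L 'k) \<Rightarrow> complex) set"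
  where "continuous_dual A = {\<beta>. clinear_on A \<beta> \<and> continuous_on A \<beta>}"

definition unital_algebra_hom_on ::
    "('k :: chilbert_space \<Rightarrow>\<^sub>L 'k) set \<Rightarrow> (('k \<Rightarrow>\<^sub>L 'k) \<Rightarrow> ('h :: chilbert_space \<Rightarrow>\<^sub>L 'h)) \<Rightarrow> bool"
  where "unital_algebra_hom_on A \<theta> \<longleftrightarrow>
    \<theta> ` A \<subseteq> bounded_operators \<and>
    clinear_on A \<theta> \<and>
    (\<forall>S\<in>A. \<forall>T\<in>A. \<theta> (S o\<^sub>L T) = \<theta> S o\<^sub>L \<theta> T) \<and>
    \<theta> id_blinfun = id_blinfun"


section \<open>Matrices of operators and ampliations\<close>

definition matrices_over :: "('k :: chilbert_space \<Rightarrow>\<^sub>L 'k) set \<Rightarrow> (('k \<Rightarrow>\<^sub>L 'k) ^ 'n ^ 'n) set"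
  where "matrices_over A = {a. \<forall>i j. a $ i $ j \<in> A}"

text \<open>
  The operator on the direct sum given by an operator matrix.  The norm of a matrix is the norm of
  this operator, and not the Euclidean norm that the type of matrices carries as a type of vectors.
\<close>

lift_definition matrix_operator ::
    "('k :: chilbert_space \<Rightarrow>\<^sub>L 'k) ^ 'n ^ 'n \<Rightarrow> ('k ^ 'n) \<Rightarrow>\<^sub>L ('k ^ 'n)"
  is "\<lambda>a x. \<chi> i. \<Sum>j\<in>UNIV. blinfun_apply (a $ i $ j) (x $ j)"
proof -
  fix a :: "('k \<Rightarrow>\<^sub>L 'k) ^ 'n ^ 'n"
  have row: "bounded_linear (\<lambda>x :: 'k ^ 'n. \<Sum>j\<in>UNIV. blinfun_apply (a $ i $ j) (x $ j))" for i
    by (intro bounded_linear_sum blinfun.bounded_linear_right[THEN bounded_linear_compose]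
        bounded_linear_vec_nth)
  show "bounded_linear (\<lambda>x :: 'k ^ 'n. \<chi> i. \<Sum>j\<in>UNIV. blinfun_apply (a $ i $ j) (x $ j))"
  proof (rule bounded_linear_intro)
    fix x :: "'k ^ 'n"
    let ?f = "\<lambda>i (x :: 'k ^ 'n). \<Sum>j\<in>UNIV. blinfun_apply (a $ i $ j) (x $ j)"
    have "norm (\<chi> i. ?f i x) \<le> (\<Sum>i\<in>UNIV. norm (?f i x))"
      unfolding norm_vec_def by (simp add: L2_set_le_sum)
    also have "\<dots> \<le> (\<Sum>i\<in>UNIV. onorm (?f i) * norm x)"
      by (intro sum_mono onorm row)
    finally show "norm (\<chi> i. ?f i x) \<le> norm x * (\<Sum>i\<in>UNIV. onorm (?f i))"
      by (simp add: sum_distrib_left mult.commute)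
  qed (simp_all add: vec_eq_iff blinfun.add_right blinfun.scaleR_right sum.distrib scaleR_sum_right)
qed

definition ampliation ::
    "(('k :: chilbert_space \<Rightarrow>\<^sub>L 'k) \<Rightarrow> ('h :: chilbert_space \<Rightarrow>\<^sub>L 'h)) \<Rightarrow>
      ('k \<Rightarrow>\<^sub>L 'k) ^ 'n ^ 'n \<Rightarrow> ('h \<Rightarrow>\<^sub>L 'h) ^ 'n ^ 'n"
  where "ampliation \<phi> a = (\<chi> i j. \<phi> (a $ i $ j))"

text \<open>
  The operator norm of the \<open>n\<close>-th ampliation of \<open>\<phi>\<close> on the matrices over \<open>A\<close>, where \<open>n\<close> is the
  cardinality of the index type.  For a continuous complex-linear \<open>\<phi>\<close> on a linear subspace \<open>A\<close> the
  supremum ranges over a bounded set, since the norm of a matrix dominates the norms of its entries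
  and is dominated by their sum.
\<close>

definition ampliation_norm ::
    "'n :: finite itself \<Rightarrow> ('k :: chilbert_space \<Rightarrow>\<^sub>L 'k) set \<Rightarrow>
      (('k \<Rightarrow>\<^sub>L 'k) \<Rightarrow> ('h :: chilbert_space \<Rightarrow>\<^sub>L 'h)) \<Rightarrow> real"
  where "ampliation_norm _ A \<phi> =
    (SUP a \<in> {a :: ('k \<Rightarrow>\<^sub>L 'k) ^ 'n ^ 'n. a \<in> matrices_over A \<and> norm (matrix_operator a) \<le> 1}.
      norm (matrix_operator (ampliation \<phi> a)))"

end

(*
  Suppose M = norm \<theta>^(n) > 1.  For a contraction a over A and a scalar matrix C, the matrix
  a + e (C - a C^* a) has norm 1 + O(e^2), and \<theta>^(n) fixes scalar matrices, so comparison with M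
  at an almost norming unit vector x of T = \<theta>^(n)(a) shows
  (1 - M^2) Re <Cx, Tx> \<le> O(e).  Here T^* T x is close to M^2 x, which replaces <Tx, T C^* T x> by
  M^2 <Cx, Tx>.  Taking C = \<beta>^(n)(a), the added scalar part Cx cannot shorten Tx in the limit,
  since norm (Tx + Cx) norm (Tx) \<ge> Re <Tx + Cx, Tx>.
*)

theory Submission
  imports Defs
begin

section \<open>First and second order estimates in real inner product spaces\<close>

lemma norm_add_scaleR_square:
  fixes u v :: "'a :: real_inner"
  shows "(norm (u + e *\<^sub>R v))\<^sup>2 = (norm u)\<^sup>2 + 2 * e * inner u v + e\<^sup>2 * (norm v)\<^sup>2"
  unfolding power2_norm_eq_inner
  by (simp add: inner_commute algebra_simps power2_eq_square)

text \<open>The form M^2 - T^* T is positive; evaluate it at x - e y and expand. This is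
  Cauchy-Schwarz with weight e: if the form nearly vanishes at x, its value at the pair (x, y) is
  small too.\<close>

lemma gram_amgm:
  fixes T :: "'a :: real_inner \<Rightarrow>\<^sub>L 'b :: real_inner"
  assumes "norm T \<le> M"
  shows "2 * e * (M\<^sup>2 * inner x y - inner (T x) (T y))
    \<le> (M\<^sup>2 * (norm x)\<^sup>2 - (norm (T x))\<^sup>2) + e\<^sup>2 * (M\<^sup>2 * (norm y)\<^sup>2 - (norm (T y))\<^sup>2)"
proof -
  let ?v = "x + (- e) *\<^sub>R y"
  have "norm (T ?v) \<le> M * norm ?v"
    using norm_blinfun[of T ?v] mult_right_mono[OF assms norm_ge_zero[of ?v]] by linarith
  then have "(norm (T ?v))\<^sup>2 \<le> (M * norm ?v)\<^sup>2"
    by (intro power_mono) auto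
  then have "(norm (T x + (- e) *\<^sub>R T y))\<^sup>2 \<le> M\<^sup>2 * (norm (x + (- e) *\<^sub>R y))\<^sup>2"
    by (simp only: power_mult_distrib blinfun.add_right blinfun.scaleR_right)
  then show ?thesis
    unfolding norm_add_scaleR_square by (simp add: algebra_simps)
qed

text \<open>
  The bracket \<open>C - a C\<^sup>* a\<close> is the derivative at \<open>C = 0\<close> of the operator Moebius transformations
  of the unit ball, so moving \<open>a\<close> along it leaves the ball only to second order.
\<close>

lemma norm_moebius_variation_le:
  fixes a C D :: "'a :: real_inner \<Rightarrow>\<^sub>L 'a"
  assumes a: "norm a \<le> 1" and c: "norm C \<le> c" "norm D \<le> c"
    and adj: "\<And>x y. inner (C x) y = inner x (D y)"
  shows "norm (a + e *\<^sub>R (C - (a o\<^sub>L D o\<^sub>L a))) \<le> sqrt (1 + 5 * c\<^sup>2 * e\<^sup>2)"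
proof (rule norm_blinfun_bound)
  show "0 \<le> sqrt (1 + 5 * c\<^sup>2 * e\<^sup>2)" by simp
  fix x
  have c0: "0 \<le> c" using c(1) norm_ge_zero order_trans by blast
  have na: "norm (a v) \<le> norm v" for v
    using norm_blinfun[of a v] mult_right_mono[OF a norm_ge_zero[of v]] by linarith
  have nc: "norm (C v) \<le> c * norm v" and nd: "norm (D v) \<le> c * norm v" for v
    using norm_blinfun[of C v] mult_right_mono[OF c(1) norm_ge_zero[of v]]
      norm_blinfun[of D v] mult_right_mono[OF c(2) norm_ge_zero[of v]] by linarith+
  define y where "y = D (a x)"
  define w where "w = C x - a y"
  have y: "norm y \<le> c * norm x"
    unfolding y_def using nd[of "a x"] mult_left_mono[OF na[of x] c0] by linarith
  have w: "norm w \<le> 2 * c * norm x"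
    unfolding w_def using norm_triangle_ineq4[of "C x" "a y"] nc[of x] na[of y] y by linarith
  \<comment> \<open>By adjointness the first-order coefficient \<open>inner (a x) w\<close> is the
    value of I - a^* a at (x, y). It is thus absorbed by the gap between the squared norms of x and
    \<open>a x\<close>, up to order e^2.\<close>
  have P: "2 * e * (inner x y - inner (a x) (a y))
      \<le> ((norm x)\<^sup>2 - (norm (a x))\<^sup>2) + e\<^sup>2 * ((norm y)\<^sup>2 - (norm (a y))\<^sup>2)"
    using gram_amgm[OF a, of e x y] by simp
  have "(norm (a x + e *\<^sub>R w))\<^sup>2 =
      (norm (a x))\<^sup>2 + 2 * e * (inner x y - inner (a x) (a y)) + e\<^sup>2 * (norm w)\<^sup>2"
    unfolding norm_add_scaleR_square using adj[of x "a x"]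
    by (simp add: w_def y_def inner_diff_right inner_commute)
  also have "\<dots> \<le> (norm x)\<^sup>2 + e\<^sup>2 * (norm y)\<^sup>2 + e\<^sup>2 * (norm w)\<^sup>2"
  proof -
    have "e\<^sup>2 * ((norm y)\<^sup>2 - (norm (a y))\<^sup>2) \<le> e\<^sup>2 * (norm y)\<^sup>2"
      by (intro mult_left_mono) auto
    with P show ?thesis by linarith
  qed
  \<comment> \<open>The 5 is 1 + 4, from the bounds c on y and 2 c on w relative to the norm of
    x.\<close>
  also have "\<dots> \<le> (norm x)\<^sup>2 + e\<^sup>2 * (c * norm x)\<^sup>2 + e\<^sup>2 * (2 * c * norm x)\<^sup>2"
    by (intro add_mono mult_left_mono power_mono y w) auto
  also have "\<dots> = (1 + 5 * c\<^sup>2 * e\<^sup>2) * (norm x)\<^sup>2"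
    by (simp add: algebra_simps power2_eq_square)
  finally have "sqrt ((norm (a x + e *\<^sub>R w))\<^sup>2) \<le> sqrt ((1 + 5 * c\<^sup>2 * e\<^sup>2) * (norm x)\<^sup>2)"
    by (rule real_sqrt_le_mono)
  then show "norm ((a + e *\<^sub>R (C - (a o\<^sub>L D o\<^sub>L a))) x) \<le> sqrt (1 + 5 * c\<^sup>2 * e\<^sup>2) * norm x"
    by (simp add: real_sqrt_mult w_def y_def plus_blinfun.rep_eq minus_blinfun.rep_eq
        scaleR_blinfun.rep_eq)
qed

text \<open>At x the form M^2 - T^* T is at most e^2, so exchanging \<open>inner (T x) (T y)\<close>
  for M^2 \<open>inner x y\<close> costs only O(e). The first-order term of the variation is then (1
  - M^2) \<open>inner x y\<close>, which \<open>var\<close> bounds above by O(e).\<close>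

lemma inner_extremal_ge:
  fixes T C D :: "'a :: real_inner \<Rightarrow>\<^sub>L 'a"
  assumes M: "1 < M" and e: "0 < e" and T: "norm T \<le> M" and c: "norm D \<le> c"
    and adj: "\<And>x y. inner (C x) y = inner x (D y)"
    and var: "norm (T + e *\<^sub>R (C - (T o\<^sub>L D o\<^sub>L T))) \<le> M * sqrt (1 + 5 * c\<^sup>2 * e\<^sup>2)"
    and x: "norm x = 1" and ext: "M\<^sup>2 - e\<^sup>2 \<le> (norm (T x))\<^sup>2"
  shows "- e * ((2 + 5 * c\<^sup>2 * M\<^sup>2 + c\<^sup>2 * M^4) / (2 * (M\<^sup>2 - 1))) \<le> inner (C x) (T x)"
proof -
  have c0: "0 \<le> c" using c norm_ge_zero order_trans by blast
  have Tx: "norm (T x) \<le> M"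
    using norm_blinfun[of T x] T x by simp
  define y where "y = D (T x)"
  have y: "norm y \<le> c * M"
    unfolding y_def using norm_blinfun[of D "T x"] mult_mono[OF c Tx c0 norm_ge_zero] by linarith
  have xy: "inner x y = inner (C x) (T x)"
    by (simp add: adj y_def)
  have "norm (T x + e *\<^sub>R (C x - T y)) \<le> M * sqrt (1 + 5 * c\<^sup>2 * e\<^sup>2)"
  proof -
    have "(T + e *\<^sub>R (C - (T o\<^sub>L D o\<^sub>L T))) x = T x + e *\<^sub>R (C x - T y)"
      by (simp add: y_def plus_blinfun.rep_eq minus_blinfun.rep_eq scaleR_blinfun.rep_eq)
    then show ?thesis
      using norm_blinfun[of "T + e *\<^sub>R (C - (T o\<^sub>L D o\<^sub>L T))" x] var x by simp
  qed
  then have "(norm (T x + e *\<^sub>R (C x - T y)))\<^sup>2 \<le> (M * sqrt (1 + 5 * c\<^sup>2 * e\<^sup>2))\<^sup>2"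
    by (intro power_mono) auto
  then have up: "(norm (T x + e *\<^sub>R (C x - T y)))\<^sup>2 \<le> M\<^sup>2 * (1 + 5 * c\<^sup>2 * e\<^sup>2)"
    by (simp add: power_mult_distrib)
  have "(norm (T x + e *\<^sub>R (C x - T y)))\<^sup>2 =
      (norm (T x))\<^sup>2 + 2 * e * (inner x y - inner (T x) (T y)) + (norm (e *\<^sub>R (C x - T y)))\<^sup>2"
    unfolding norm_add_scaleR_square xy
    by (simp add: inner_diff_right inner_commute power_mult_distrib)
  then have low: "M\<^sup>2 - e\<^sup>2 + 2 * e * (inner x y - inner (T x) (T y)) \<le> M\<^sup>2 * (1 + 5 * c\<^sup>2 * e\<^sup>2)"
    using up ext zero_le_power2[of "norm (e *\<^sub>R (C x - T y))"] by linarith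
  \<comment> \<open>The weight is -e, so that \<open>inner (T x) (T y)\<close> enters with the sign
    opposite to that in \<open>low\<close>.\<close>
  have "2 * e * (inner (T x) (T y) - M\<^sup>2 * inner x y)
      \<le> (M\<^sup>2 - (norm (T x))\<^sup>2) + e\<^sup>2 * (M\<^sup>2 * (norm y)\<^sup>2 - (norm (T y))\<^sup>2)"
    using gram_amgm[OF T, of "- e" x y] x by (simp add: algebra_simps)
  also have "\<dots> \<le> e\<^sup>2 + e\<^sup>2 * (M\<^sup>2 * (c * M)\<^sup>2)"
  proof (intro add_mono mult_left_mono)
    have "M\<^sup>2 * (norm y)\<^sup>2 \<le> M\<^sup>2 * (c * M)\<^sup>2"
      by (intro mult_left_mono power_mono y) auto
    then show "M\<^sup>2 * (norm y)\<^sup>2 - (norm (T y))\<^sup>2 \<le> M\<^sup>2 * (c * M)\<^sup>2"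
      using zero_le_power2[of "norm (T y)"] by linarith
  qed (use ext in auto)
  \<comment> \<open>Adding \<open>low\<close> cancels \<open>inner (T x) (T y)\<close>. The 2
    collects the loss e^2 from \<open>ext\<close> on both sides, 5 c^2 M^2 comes from
    \<open>var\<close>, and c^2 M^4 from the bound on y.\<close>
  finally have "e * (2 * (1 - M\<^sup>2) * inner x y) \<le> e * (e * (2 + 5 * c\<^sup>2 * M\<^sup>2 + c\<^sup>2 * M^4))"
    using low by (simp add: algebra_simps power2_eq_square power4_eq_xxxx)
  then have "2 * (1 - M\<^sup>2) * inner x y \<le> e * (2 + 5 * c\<^sup>2 * M\<^sup>2 + c\<^sup>2 * M^4)"
    using e by simp
  \<comment> \<open>Since M > 1, division by the negative number 1 - M^2 turns the upper bound into
    a lower one.\<close>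
  moreover have "0 < M\<^sup>2 - 1"
    using M by (simp add: one_less_power)
  ultimately show ?thesis
    unfolding xy[symmetric] by (simp add: field_simps)
qed

section \<open>Norming vectors, complex scalars and bounds from continuity\<close>

lemma norm_blinfun_gt_witness:
  fixes T :: "'a :: real_normed_vector \<Rightarrow>\<^sub>L 'b :: real_normed_vector"
  assumes "0 \<le> m" and "m < norm T"
  obtains x where "norm x = 1" and "m < norm (T x)"
proof -
  obtain x where x: "m * norm x < norm (T x)"
    using norm_blinfun_bound[of m T] assms by (meson linorder_not_le)
  then have "x \<noteq> 0" by auto
  then show thesis
    using x by (intro that[of "x /\<^sub>R norm x"]) (auto simp: blinfun.scaleR_right field_simps)
qed

lemma scaleC_of_real_blinfun: "complex_of_real r *\<^sub>C T = r *\<^sub>R T"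
  for T :: "'a :: real_normed_vector \<Rightarrow>\<^sub>L 'b :: chilbert_space"
  by (rule blinfun_eqI) (simp add: scaleC_blinfun.rep_eq scaleR_blinfun.rep_eq scaleR_scaleC)

lemma norm_scaleC_blinfun_le: "norm (c *\<^sub>C T) \<le> cmod c * norm T"
  for T :: "'a :: real_normed_vector \<Rightarrow>\<^sub>L 'b :: chilbert_space"
proof (rule norm_blinfun_bound)
  fix x
  show "norm ((c *\<^sub>C T) x) \<le> cmod c * norm T * norm x"
    using mult_left_mono[OF norm_blinfun[of T x] norm_ge_zero[of c]]
    by (simp add: scaleC_blinfun.rep_eq norm_scaleC mult.assoc)
qed simp

lemma cinner_scaleC_left: "cinner (c *\<^sub>C x) y = cnj c * cinner x y" for x :: "'a :: chilbert_space"
  using cinner_commute[of "c *\<^sub>C x" y] cinner_commute[of x y] by (simp add: cinner_scaleC_right)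

lemma inner_scaleC_left: "inner (c *\<^sub>C x) y = inner x (cnj c *\<^sub>C y)" for x :: "'a :: chilbert_space"
  by (simp add: inner_cinner cinner_scaleC_left cinner_scaleC_right)

text \<open>Continuity at 0 gives a radius d below which the values have norm less than 1; each
  nonzero x is rescaled to norm d/2. The form with a set A serves both \<theta> and \<beta>, which
  are controlled only on the algebra.\<close>

lemma continuous_homogeneous_bounded:
  fixes f :: "'a :: real_normed_vector \<Rightarrow> 'b :: real_normed_vector"
  assumes cont: "continuous_on A f" and zero: "0 \<in> A"
    and A: "\<And>r x. x \<in> A \<Longrightarrow> r *\<^sub>R x \<in> A" and f: "\<And>r x. x \<in> A \<Longrightarrow> f (r *\<^sub>R x) = r *\<^sub>R f x"
  obtains K where "0 \<le> K" and "\<And>x. x \<in> A \<Longrightarrow> norm (f x) \<le> K * norm x"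
proof -
  have f0: "f 0 = 0" using f[OF zero, of 0] by simp
  obtain d where d: "d > 0" "\<And>x. x \<in> A \<Longrightarrow> norm x < d \<Longrightarrow> norm (f x) < 1"
    using cont zero f0 unfolding continuous_on_iff by (metis dist_0_norm dist_commute zero_less_one)
  have "norm (f x) \<le> 2 / d * norm x" if x: "x \<in> A" for x
  proof (cases "x = 0")
    case True
    then show ?thesis using f0 by simp
  next
    case False
    define r where "r = d / (2 * norm x)"
    have r: "r > 0" "r * norm x < d" using False d by (auto simp: r_def)
    then have "r * norm (f x) < 1"
      using d(2)[OF A[OF x, of r]] f[OF x, of r] by simp
    then show ?thesis
      using False d(1) by (simp add: r_def field_simps)
  qed
  then show thesis using d(1) by (intro that[of "2 / d"]) auto
qed


section \<open>Operator matrices and scalar matrices\<close>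

lemma matrix_operator_add: "matrix_operator (a + b) = matrix_operator a + matrix_operator b"
  by (rule blinfun_eqI)
    (simp add: vec_eq_iff matrix_operator.rep_eq plus_blinfun.rep_eq sum.distrib)

lemma matrix_operator_diff: "matrix_operator (a - b) = matrix_operator a - matrix_operator b"
  by (rule blinfun_eqI)
    (simp add: vec_eq_iff matrix_operator.rep_eq minus_blinfun.rep_eq sum_subtractf)

lemma matrix_operator_scaleR: "matrix_operator (r *\<^sub>R a) = r *\<^sub>R matrix_operator a"
  by (rule blinfun_eqI)
    (simp add: vec_eq_iff matrix_operator.rep_eq scaleR_blinfun.rep_eq scaleR_sum_right)

text \<open>This crude estimate suffices for its two uses: finiteness of the suprema, and a constant
  in front of powers of e.\<close>

lemma norm_matrix_operator_le:
  fixes a :: "('k :: chilbert_space \<Rightarrow>\<^sub>L 'k) ^ 'n ^ 'n"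
  shows "norm (matrix_operator a) \<le> (\<Sum>i\<in>UNIV. \<Sum>j\<in>UNIV. norm (a $ i $ j))"
proof (rule norm_blinfun_bound)
  fix x :: "'k ^ 'n"
  have "norm (matrix_operator a x) \<le> (\<Sum>i\<in>UNIV. norm (matrix_operator a x $ i))"
    unfolding norm_vec_def by (simp add: L2_set_le_sum)
  also have "\<dots> \<le> (\<Sum>i\<in>UNIV. \<Sum>j\<in>UNIV. norm (a $ i $ j) * norm x)"
  proof (rule sum_mono)
    fix i
    have "norm (matrix_operator a x $ i) \<le> (\<Sum>j\<in>UNIV. norm ((a $ i $ j) (x $ j)))"
      by (simp add: matrix_operator.rep_eq norm_sum)
    also have "\<dots> \<le> (\<Sum>j\<in>UNIV. norm (a $ i $ j) * norm x)"
      by (intro sum_mono order_trans[OF norm_blinfun] mult_left_mono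
          Finite_Cartesian_Product.norm_nth_le) auto
    finally show "norm (matrix_operator a x $ i) \<le> (\<Sum>j\<in>UNIV. norm (a $ i $ j) * norm x)" .
  qed
  finally show "norm (matrix_operator a x) \<le> (\<Sum>i\<in>UNIV. \<Sum>j\<in>UNIV. norm (a $ i $ j)) * norm x"
    by (simp add: sum_distrib_right)
qed (simp add: sum_nonneg)

text \<open>An entry is the operator compressed between the isometric inclusion of the j-th summand
  and the contractive i-th coordinate.\<close>

lemma norm_entry_le: "norm (a $ i $ j) \<le> norm (matrix_operator a)"
proof (rule norm_blinfun_bound)
  fix x
  have "(a $ i $ j) x = matrix_operator a (axis j x) $ i"
    by (simp add: matrix_operator.rep_eq axis_def if_distrib[of "blinfun_apply _"] blinfun.zero_right
        cong: if_cong)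
  also have "norm \<dots> \<le> norm (matrix_operator a (axis j x))"
    by (rule Finite_Cartesian_Product.norm_nth_le)
  also have "\<dots> \<le> norm (matrix_operator a) * norm x"
    using norm_blinfun[of "matrix_operator a" "axis j x"]
    by (simp add: norm_eq_sqrt_inner[of "axis j x"] norm_eq_sqrt_inner[of x] inner_axis axis_nth)
  finally show "norm ((a $ i $ j) x) \<le> norm (matrix_operator a) * norm x" .
qed simp

text \<open>The product is kept at the level of entries, where \<open>ampliation\<close> acts, and
  is identified with composition of operators by \<open>matrix_operator_comp\<close>.\<close>

definition matrix_comp ::
    "('k :: chilbert_space \<Rightarrow>\<^sub>L 'k) ^ 'n ^ 'n \<Rightarrow> ('k \<Rightarrow>\<^sub>L 'k) ^ 'n ^ 'n \<Rightarrow> ('k \<Rightarrow>\<^sub>L 'k) ^ 'n ^ 'n"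
  where "matrix_comp a b = (\<chi> i j. \<Sum>k\<in>UNIV. a $ i $ k o\<^sub>L b $ k $ j)"

lemma matrix_operator_comp:
  "matrix_operator (matrix_comp a b) = matrix_operator a o\<^sub>L matrix_operator b"
proof (rule blinfun_eqI)
  fix x
  have "(\<Sum>j\<in>UNIV. \<Sum>k\<in>UNIV. (a $ i $ k) ((b $ k $ j) (x $ j)))
      = (\<Sum>k\<in>UNIV. \<Sum>j\<in>UNIV. (a $ i $ k) ((b $ k $ j) (x $ j)))" for i
    by (rule sum.swap)
  then show "matrix_operator (matrix_comp a b) x = (matrix_operator a o\<^sub>L matrix_operator b) x"
    by (simp add: vec_eq_iff matrix_operator.rep_eq matrix_comp_def blinfun.sum_left
        blinfun.sum_right)
qed

text \<open>Polymorphic in the Hilbert space, so that one complex matrix gives operators on the sums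
  of copies of both \<K> and \<H>.\<close>

definition scalar_matrix :: "complex ^ 'n ^ 'n \<Rightarrow> ('k :: chilbert_space \<Rightarrow>\<^sub>L 'k) ^ 'n ^ 'n"
  where "scalar_matrix B = (\<chi> i j. B $ i $ j *\<^sub>C id_blinfun)"

text \<open>The bound does not mention the Hilbert space, so one constant serves on the side of A
  and on the side of its image.\<close>

lemma norm_scalar_matrix_le:
  "norm (matrix_operator (scalar_matrix B)) \<le> (\<Sum>i\<in>UNIV. \<Sum>j\<in>UNIV. cmod (B $ i $ j))"
proof (rule order_trans[OF norm_matrix_operator_le], intro sum_mono)
  fix i j
  \<comment> \<open>Equality fails on the zero space, which the class admits.\<close>
  have "norm (id_blinfun :: 'a \<Rightarrow>\<^sub>L 'a) \<le> 1"
    by (rule norm_blinfun_bound) simp_all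
  then show "norm (scalar_matrix B $ i $ j :: 'a \<Rightarrow>\<^sub>L 'a) \<le> cmod (B $ i $ j)"
    unfolding scalar_matrix_def
    by (auto intro!: order_trans[OF norm_scaleC_blinfun_le] mult_left_le)
qed

text \<open>The adjoint of a scalar matrix is its conjugate transpose, again a scalar matrix. Hence
  C^* lies over A although A need not be self-adjoint.\<close>

lemma inner_scalar_matrix:
  "inner (matrix_operator (scalar_matrix B) x) y
    = inner x (matrix_operator (scalar_matrix (\<chi> i j. cnj (B $ j $ i))) y)"
proof -
  have "inner (matrix_operator (scalar_matrix B) x) y
      = (\<Sum>i\<in>UNIV. \<Sum>j\<in>UNIV. inner (x $ j) (cnj (B $ i $ j) *\<^sub>C y $ i))"
    by (simp add: inner_vec_def matrix_operator.rep_eq scalar_matrix_def scaleC_blinfun.rep_eq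
        inner_sum_left inner_scaleC_left)
  also have "\<dots> = (\<Sum>j\<in>UNIV. \<Sum>i\<in>UNIV. inner (x $ j) (cnj (B $ i $ j) *\<^sub>C y $ i))"
    by (rule sum.swap)
  finally show ?thesis
    by (simp add: inner_vec_def matrix_operator.rep_eq scalar_matrix_def scaleC_blinfun.rep_eq
        inner_sum_right)
qed

section \<open>Unital operator algebras and boundedness of ampliations\<close>

locale operator_algebra =
  fixes A :: "('k :: chilbert_space \<Rightarrow>\<^sub>L 'k) set"
  assumes unital: "unital_operator_algebra A"
begin

lemma id_mem: "id_blinfun \<in> A"
  and add_mem: "S \<in> A \<Longrightarrow> T \<in> A \<Longrightarrow> S + T \<in> A"
  and scaleC_mem: "T \<in> A \<Longrightarrow> c *\<^sub>C T \<in> A"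
  and comp_mem: "S \<in> A \<Longrightarrow> T \<in> A \<Longrightarrow> S o\<^sub>L T \<in> A"
  using unital by (auto simp: unital_operator_algebra_def)

lemma scaleR_mem: "T \<in> A \<Longrightarrow> r *\<^sub>R T \<in> A"
  using scaleC_mem[of T "complex_of_real r"] by (simp add: scaleC_of_real_blinfun)

lemma zero_mem: "0 \<in> A"
  using scaleR_mem[OF id_mem, of 0] by simp

lemma diff_mem: "S \<in> A \<Longrightarrow> T \<in> A \<Longrightarrow> S - T \<in> A"
  using add_mem[of S "(-1) *\<^sub>R T"] scaleR_mem[of T "-1"] by simp

lemma sum_mem: "(\<And>i. i \<in> I \<Longrightarrow> f i \<in> A) \<Longrightarrow> sum f I \<in> A"
  by (induction I rule: infinite_finite_induct) (auto simp: zero_mem add_mem)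

lemma matrices_add: "a \<in> matrices_over A \<Longrightarrow> b \<in> matrices_over A \<Longrightarrow> a + b \<in> matrices_over A"
  and matrices_diff: "a \<in> matrices_over A \<Longrightarrow> b \<in> matrices_over A \<Longrightarrow> a - b \<in> matrices_over A"
  and matrices_scaleR: "a \<in> matrices_over A \<Longrightarrow> r *\<^sub>R a \<in> matrices_over A"
  and matrices_comp:
    "a \<in> matrices_over A \<Longrightarrow> b \<in> matrices_over A \<Longrightarrow> matrix_comp a b \<in> matrices_over A"
  and matrices_scalar: "scalar_matrix B \<in> matrices_over A"
  and matrices_zero: "0 \<in> matrices_over A"
  by (auto simp: matrices_over_def matrix_comp_def scalar_matrix_def add_mem diff_mem scaleR_mem
      zero_mem id_mem scaleC_mem intro!: sum_mem comp_mem)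

lemma clinear_continuous_bounded:
  fixes f :: "('k \<Rightarrow>\<^sub>L 'k) \<Rightarrow> ('h :: chilbert_space \<Rightarrow>\<^sub>L 'h)"
  assumes "clinear_on A f" and "continuous_on A f"
  obtains K where "0 \<le> K" and "\<And>x. x \<in> A \<Longrightarrow> norm (f x) \<le> K * norm x"
proof (rule continuous_homogeneous_bounded[of A f])
  show "f (r *\<^sub>R x) = r *\<^sub>R f x" if "x \<in> A" for r x
    using assms(1) that by (simp add: clinear_on_def flip: scaleC_of_real_blinfun)
qed (use assms(2) zero_mem scaleR_mem that in auto)

lemma dual_bounded:
  assumes "\<beta> \<in> continuous_dual A"
  obtains K where "0 \<le> K" and "\<And>x. x \<in> A \<Longrightarrow> cmod (\<beta> x) \<le> K * norm x"
proof (rule continuous_homogeneous_bounded[of A \<beta>])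
  show "\<beta> (r *\<^sub>R x) = r *\<^sub>R \<beta> x" if "x \<in> A" for r x
    using assms that
    by (simp add: continuous_dual_def clinear_on_def scaleR_scaleC flip: scaleC_of_real_blinfun)
qed (use assms zero_mem scaleR_mem that in \<open>auto simp: continuous_dual_def\<close>)

text \<open>A real supremum bounds its members only over a bounded set. Here n^2 K is a bound,
  because the entries of a contraction are contractions.\<close>

lemma norm_ampliation_le:
  fixes f :: "('k \<Rightarrow>\<^sub>L 'k) \<Rightarrow> ('h :: chilbert_space \<Rightarrow>\<^sub>L 'h)"
    and a :: "('k \<Rightarrow>\<^sub>L 'k) ^ 'n ^ 'n"
  assumes K: "0 \<le> K" "\<And>x. x \<in> A \<Longrightarrow> norm (f x) \<le> K * norm x"
    and a: "a \<in> matrices_over A" "norm (matrix_operator a) \<le> 1"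
  shows "norm (matrix_operator (ampliation f a)) \<le> ampliation_norm TYPE('n) A f"
  unfolding ampliation_norm_def
proof (rule cSUP_upper)
  have "norm (matrix_operator (ampliation f b)) \<le> (\<Sum>i::'n\<in>UNIV. \<Sum>j::'n\<in>UNIV. K)"
    if b: "b \<in> matrices_over A" "norm (matrix_operator b) \<le> 1" for b :: "('k \<Rightarrow>\<^sub>L 'k) ^ 'n ^ 'n"
  proof (rule order_trans[OF norm_matrix_operator_le], intro sum_mono)
    fix i j
    have "norm (f (b $ i $ j)) \<le> K * norm (b $ i $ j)"
      using b(1) by (intro K) (simp add: matrices_over_def)
    also have "\<dots> \<le> K * 1"
      using norm_entry_le[of b i j] b(2) by (intro mult_left_mono K) simp
    finally show "norm (ampliation f b $ i $ j) \<le> K"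
      by (simp add: ampliation_def)
  qed
  then show "bdd_above ((\<lambda>a. norm (matrix_operator (ampliation f a))) `
      {a :: ('k \<Rightarrow>\<^sub>L 'k) ^ 'n ^ 'n. a \<in> matrices_over A \<and> norm (matrix_operator a) \<le> 1})"
    by (intro bdd_aboveI2[where M = "\<Sum>i::'n\<in>UNIV. \<Sum>j::'n\<in>UNIV. K"]) auto
qed (use a in auto)

end

section \<open>Ampliations of the homomorphism and comparison with the perturbed map\<close>

locale operator_algebra_hom = operator_algebra A
  for A :: "('k :: chilbert_space \<Rightarrow>\<^sub>L 'k) set" +
  fixes \<theta> :: "('k \<Rightarrow>\<^sub>L 'k) \<Rightarrow> ('h :: chilbert_space \<Rightarrow>\<^sub>L 'h)"
  assumes hom: "unital_algebra_hom_on A \<theta>" and continuous: "continuous_on A \<theta>"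
begin

lemma clinear: "clinear_on A \<theta>"
  and hom_id: "\<theta> id_blinfun = id_blinfun"
  and hom_comp: "S \<in> A \<Longrightarrow> T \<in> A \<Longrightarrow> \<theta> (S o\<^sub>L T) = \<theta> S o\<^sub>L \<theta> T"
  using hom by (auto simp: unital_algebra_hom_on_def)

lemma hom_add: "S \<in> A \<Longrightarrow> T \<in> A \<Longrightarrow> \<theta> (S + T) = \<theta> S + \<theta> T"
  and hom_scaleC: "T \<in> A \<Longrightarrow> \<theta> (c *\<^sub>C T) = c *\<^sub>C \<theta> T"
  using clinear by (auto simp: clinear_on_def)

lemma hom_scaleR: "T \<in> A \<Longrightarrow> \<theta> (r *\<^sub>R T) = r *\<^sub>R \<theta> T"
  using hom_scaleC[of T "complex_of_real r"] by (simp add: scaleC_of_real_blinfun)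

lemma hom_zero: "\<theta> 0 = 0"
  using hom_scaleR[OF zero_mem, of 0] by simp

lemma hom_diff: "S \<in> A \<Longrightarrow> T \<in> A \<Longrightarrow> \<theta> (S - T) = \<theta> S - \<theta> T"
  using hom_add[of S "(-1) *\<^sub>R T"] hom_scaleR[of T "-1"] scaleR_mem[of T "-1"] by simp

lemma hom_sum: "(\<And>i. i \<in> I \<Longrightarrow> f i \<in> A) \<Longrightarrow> \<theta> (sum f I) = (\<Sum>i\<in>I. \<theta> (f i))"
  by (induction I rule: infinite_finite_induct) (auto simp: hom_zero hom_add sum_mem)

text \<open>Together these say that \<theta>^(n) is an algebra homomorphism fixing scalar matrices,
  so it carries the variation of a along C - a C^* a to the variation of its image along the same
  C.\<close>

lemma ampliation_add:
    "a \<in> matrices_over A \<Longrightarrow> b \<in> matrices_over A \<Longrightarrow>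
      ampliation \<theta> (a + b) = ampliation \<theta> a + ampliation \<theta> b"
  and ampliation_diff:
    "a \<in> matrices_over A \<Longrightarrow> b \<in> matrices_over A \<Longrightarrow>
      ampliation \<theta> (a - b) = ampliation \<theta> a - ampliation \<theta> b"
  and ampliation_scaleR:
    "a \<in> matrices_over A \<Longrightarrow> ampliation \<theta> (r *\<^sub>R a) = r *\<^sub>R ampliation \<theta> a"
  and ampliation_comp:
    "a \<in> matrices_over A \<Longrightarrow> b \<in> matrices_over A \<Longrightarrow>
      ampliation \<theta> (matrix_comp a b) = matrix_comp (ampliation \<theta> a) (ampliation \<theta> b)"
  and ampliation_scalar: "ampliation \<theta> (scalar_matrix B) = scalar_matrix B"
  by (simp_all add: vec_eq_iff ampliation_def matrices_over_def matrix_comp_def scalar_matrix_def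
      hom_add hom_diff hom_scaleR hom_sum hom_comp comp_mem hom_scaleC id_mem hom_id)

text \<open>Rescaling to the unit ball; needed because a varied contraction may have norm slightly
  above 1.\<close>

lemma norm_ampliation_hom_le:
  fixes a :: "('k \<Rightarrow>\<^sub>L 'k) ^ 'n ^ 'n"
  assumes a: "a \<in> matrices_over A" "norm (matrix_operator a) \<le> r" and r: "0 < r"
  shows "norm (matrix_operator (ampliation \<theta> a)) \<le> ampliation_norm TYPE('n) A \<theta> * r"
proof -
  obtain K where K: "0 \<le> K" "\<And>x. x \<in> A \<Longrightarrow> norm (\<theta> x) \<le> K * norm x"
    using clinear_continuous_bounded[OF clinear continuous] by blast
  have "norm (matrix_operator (ampliation \<theta> ((1 / r) *\<^sub>R a))) \<le> ampliation_norm TYPE('n) A \<theta>"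
    using a r by (intro norm_ampliation_le[OF K] matrices_scaleR) (auto simp: matrix_operator_scaleR)
  then show ?thesis
    using a r by (simp add: ampliation_scaleR matrix_operator_scaleR field_simps)
qed

text \<open>This is the case that the 1 in the maximum leaves open. For every e > 0 one gets M^2
  \<le> N M + e^2 + e L; then e tends to 0 and M is cancelled.\<close>

lemma ampliation_norm_le_perturbed:
  assumes \<beta>: "\<beta> \<in> continuous_dual A" and M: "1 < ampliation_norm TYPE('n :: finite) A \<theta>"
  shows "ampliation_norm TYPE('n) A \<theta>
    \<le> ampliation_norm TYPE('n) A (\<lambda>a. \<theta> a + \<beta> a *\<^sub>C id_blinfun)"
proof -
  define \<psi> where "\<psi> = (\<lambda>a. \<theta> a + \<beta> a *\<^sub>C (id_blinfun :: 'h \<Rightarrow>\<^sub>L 'h))"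
  define M where "M = ampliation_norm TYPE('n) A \<theta>"
  define N where "N = ampliation_norm TYPE('n) A \<psi>"
  have M1: "1 < M" using M by (simp add: M_def)
  obtain K where K: "0 \<le> K" "\<And>x. x \<in> A \<Longrightarrow> norm (\<theta> x) \<le> K * norm x"
    using clinear_continuous_bounded[OF clinear continuous] by blast
  obtain k where k: "0 \<le> k" "\<And>x. x \<in> A \<Longrightarrow> cmod (\<beta> x) \<le> k * norm x"
    using dual_bounded[OF \<beta>] by blast
  have norm_id: "norm (id_blinfun :: 'h \<Rightarrow>\<^sub>L 'h) \<le> 1"
    by (rule norm_blinfun_bound) simp_all
  have \<psi>_bound: "norm (\<psi> x) \<le> (K + k) * norm x" if "x \<in> A" for x
  proof -
    have "norm (\<psi> x) \<le> norm (\<theta> x) + cmod (\<beta> x) * 1"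
      unfolding \<psi>_def
      by (intro norm_triangle_le add_mono order_refl order_trans[OF norm_scaleC_blinfun_le]
          mult_left_mono norm_id norm_ge_zero)
    with K(2)[OF that] k(2)[OF that] show ?thesis by (simp add: algebra_simps)
  qed
  \<comment> \<open>With c = n^2 k, neither c nor L depends on e, although the matrix a and the
    vector x chosen below do. The final limit relies on this.\<close>
  define c where "c = (\<Sum>i::'n\<in>UNIV. \<Sum>j::'n\<in>UNIV. k)"
  define L where "L = (2 + 5 * c\<^sup>2 * M\<^sup>2 + c\<^sup>2 * M^4) / (2 * (M\<^sup>2 - 1))"
  have main: "M\<^sup>2 \<le> N * M + (e\<^sup>2 + e * L)" if e: "0 < e" for e
  proof -
    \<comment> \<open>Any norm above m has square at least M^2 - e^2, as \<open>ext\<close>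
      requires; the maximum with 0 covers e > M.\<close>
    define m where "m = sqrt (max 0 (M\<^sup>2 - e\<^sup>2))"
    have m: "0 \<le> m" "m < M" "M\<^sup>2 - e\<^sup>2 \<le> m\<^sup>2"
      using M1 e by (auto simp: m_def max_def intro: real_less_lsqrt)
    obtain a :: "('k \<Rightarrow>\<^sub>L 'k) ^ 'n ^ 'n" where a: "a \<in> matrices_over A"
      "norm (matrix_operator a) \<le> 1" and am: "m < norm (matrix_operator (ampliation \<theta> a))"
    proof -
      let ?U = "{a :: ('k \<Rightarrow>\<^sub>L 'k) ^ 'n ^ 'n. a \<in> matrices_over A \<and> norm (matrix_operator a) \<le> 1}"
      \<comment> \<open>Nonemptiness is what lets a value below the supremum be exceeded by a
        member.\<close>
      have "0 \<in> ?U"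
        using matrices_zero matrix_operator_scaleR[of 0 "0 :: ('k \<Rightarrow>\<^sub>L 'k) ^ 'n ^ 'n"] by simp
      then have "\<exists>y \<in> (\<lambda>a. norm (matrix_operator (ampliation \<theta> a))) ` ?U. m < y"
        using m(2) unfolding M_def ampliation_norm_def by (intro less_cSupD) auto
      then show thesis using that by auto
    qed
    \<comment> \<open>B is \<beta>^(n)(a), so C below is exactly the scalar part that the perturbed
      map adds to T.\<close>
    define B :: "complex ^ 'n ^ 'n" where "B = (\<chi> i j. \<beta> (a $ i $ j))"
    define B' :: "complex ^ 'n ^ 'n" where "B' = (\<chi> i j. cnj (B $ j $ i))"
    define T where "T = matrix_operator (ampliation \<theta> a)"
    let ?S = "\<lambda>B. scalar_matrix B :: ('k \<Rightarrow>\<^sub>L 'k) ^ 'n ^ 'n"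
    define C where "C = (matrix_operator (scalar_matrix B) :: ('h ^ 'n) \<Rightarrow>\<^sub>L ('h ^ 'n))"
    define D where "D = (matrix_operator (scalar_matrix B') :: ('h ^ 'n) \<Rightarrow>\<^sub>L ('h ^ 'n))"
    have B: "cmod (B $ i $ j) \<le> k" for i j
    proof -
      have "cmod (B $ i $ j) \<le> k * norm (a $ i $ j)"
        using a(1) by (auto simp: B_def matrices_over_def intro: k)
      also have "\<dots> \<le> k * 1"
        using norm_entry_le[of a i j] a(2) by (intro mult_left_mono k) simp
      finally show ?thesis by simp
    qed
    have c: "(\<Sum>i\<in>UNIV. \<Sum>j\<in>UNIV. cmod (B $ i $ j)) \<le> c"
      "(\<Sum>i\<in>UNIV. \<Sum>j\<in>UNIV. cmod (B' $ i $ j)) \<le> c"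
      unfolding c_def by (intro sum_mono; simp add: B B'_def)+
    have T: "norm T \<le> M"
      using norm_ampliation_hom_le[OF a] by (simp add: T_def M_def)
    obtain x where x: "norm x = 1" "m < norm (T x)"
      using norm_blinfun_gt_witness[of m T] m am unfolding T_def by metis
    have ext: "M\<^sup>2 - e\<^sup>2 \<le> (norm (T x))\<^sup>2"
      using order_trans[OF m(3) power_mono[OF less_imp_le[OF x(2)] m(1)]] .
    \<comment> \<open>The variation is made over A, where it is nearly a contraction, and then
      pushed through \<theta>^(n) to give \<open>var\<close>.\<close>
    define b where "b = a + e *\<^sub>R (?S B - matrix_comp (matrix_comp a (?S B')) a)"
    have b: "b \<in> matrices_over A"
      unfolding b_def
      by (intro matrices_add matrices_scaleR matrices_diff matrices_comp matrices_scalar a)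
    have "matrix_operator (ampliation \<theta> b) = T + e *\<^sub>R (C - (T o\<^sub>L D o\<^sub>L T))"
      unfolding b_def T_def C_def D_def
      by (simp add: ampliation_add ampliation_scaleR ampliation_diff ampliation_comp
          ampliation_scalar matrices_add matrices_scaleR matrices_diff matrices_comp
          matrices_scalar a matrix_operator_add matrix_operator_scaleR matrix_operator_diff
          matrix_operator_comp)
    moreover have "norm (matrix_operator b) \<le> sqrt (1 + 5 * c\<^sup>2 * e\<^sup>2)"
    proof -
      have "matrix_operator b = matrix_operator a + e *\<^sub>R (matrix_operator (?S B)
          - (matrix_operator a o\<^sub>L matrix_operator (?S B') o\<^sub>L matrix_operator a))"
        unfolding b_def
        by (simp add: matrix_operator_add matrix_operator_scaleR matrix_operator_diff
            matrix_operator_comp)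
      also have "norm \<dots> \<le> sqrt (1 + 5 * c\<^sup>2 * e\<^sup>2)"
        unfolding B'_def
        by (rule norm_moebius_variation_le[OF a(2) order_trans[OF norm_scalar_matrix_le c(1)]
              order_trans[OF norm_scalar_matrix_le c(2)[unfolded B'_def]] inner_scalar_matrix])
      finally show ?thesis .
    qed
    ultimately have var: "norm (T + e *\<^sub>R (C - (T o\<^sub>L D o\<^sub>L T))) \<le> M * sqrt (1 + 5 * c\<^sup>2 * e\<^sup>2)"
      using norm_ampliation_hom_le[OF b, of "sqrt (1 + 5 * c\<^sup>2 * e\<^sup>2)"]
      by (simp add: M_def add_pos_nonneg)
    have "- e * L \<le> inner (C x) (T x)"
      unfolding L_def
    proof (rule inner_extremal_ge[OF M1 e T _ _ var x(1) ext])
      show "norm D \<le> c"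
        unfolding D_def by (rule order_trans[OF norm_scalar_matrix_le c(2)])
      show "inner (C u) v = inner u (D v)" for u v
        unfolding C_def D_def B'_def by (rule inner_scalar_matrix)
    qed
    \<comment> \<open>The lower bound on \<open>inner (C x) (T x)\<close> says that adding
      \<open>C x\<close> does not shorten the component along \<open>T x\<close>, up to e L.\<close>
    then have "(norm (T x))\<^sup>2 \<le> inner (T x + C x) (T x) + e * L"
      by (simp add: inner_add_left power2_norm_eq_inner)
    also have "inner (T x + C x) (T x) \<le> norm (T x + C x) * norm (T x)"
      by (rule norm_cauchy_schwarz)
    also have "\<dots> \<le> N * M"
    proof (rule mult_mono)
      have "ampliation \<psi> a = ampliation \<theta> a + scalar_matrix B"
        by (simp add: vec_eq_iff ampliation_def \<psi>_def B_def scalar_matrix_def)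
      then have "T + C = matrix_operator (ampliation \<psi> a)"
        by (simp add: matrix_operator_add T_def C_def)
      then have "norm (T + C) \<le> N"
        using norm_ampliation_le[of "K + k" \<psi>, OF _ \<psi>_bound a] K(1) k(1) by (simp add: N_def)
      then show N: "norm (T x + C x) \<le> N"
        using norm_blinfun[of "T + C" x] x(1) by (simp add: plus_blinfun.rep_eq)
      show "0 \<le> N" using N norm_ge_zero order_trans by blast
      show "norm (T x) \<le> M" using norm_blinfun[of T x] T x(1) by simp
    qed simp
    finally show ?thesis using ext by linarith
  qed
  have "((\<lambda>e. N * M + (e\<^sup>2 + e * L)) \<longlongrightarrow> N * M + (0\<^sup>2 + 0 * L)) (at_right 0)"
    by (intro tendsto_intros)
  moreover have "eventually (\<lambda>e. M\<^sup>2 \<le> N * M + (e\<^sup>2 + e * L)) (at_right 0)"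
    using main by (rule eventually_mono[OF eventually_at_right_less])
  ultimately have "M\<^sup>2 \<le> N * M + (0\<^sup>2 + 0 * L)"
    by (intro tendsto_lowerbound) auto
  then have "M \<le> N" using M1 by (simp add: power2_eq_square)
  then show ?thesis by (simp add: M_def N_def \<psi>_def)
qed

end

theorem theorem1p2:
  fixes A :: "('k :: chilbert_space \<Rightarrow>\<^sub>L 'k) set"
    and \<theta> :: "('k \<Rightarrow>\<^sub>L 'k) \<Rightarrow> ('h :: chilbert_space \<Rightarrow>\<^sub>L 'h)"
    and \<beta> :: "('k \<Rightarrow>\<^sub>L 'k) \<Rightarrow> complex"
  assumes "unital_operator_algebra A"
    and "unital_algebra_hom_on A \<theta>"
    and "continuous_on A \<theta>"
    and "\<beta> \<in> continuous_dual A"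
  shows "ampliation_norm TYPE('n :: finite) A \<theta>
    \<le> max 1 (ampliation_norm TYPE('n) A (\<lambda>a. \<theta> a + \<beta> a *\<^sub>C id_blinfun))"
proof -
  interpret operator_algebra_hom A \<theta>
    using assms by unfold_locales
  show ?thesis
    using ampliation_norm_le_perturbed[OF assms(4), where 'n = 'n] by linarith
qed

end
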